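(* There is a constant $c_K>1$ such that $$\mathcal J_\varepsilon(v_n)-\mathcal J_\varepsilon(u_\varepsilon)\le(1-\delta)^n\,\big(\mathcal J_\varepsilon(v_0)-\mathcal J_\varepsilon(u_\varepsilon)\big)$$ holds for $\delta:=\frac1{c_K}\big(\frac{\varepsilon_-}{\varepsilon_+}\big)^{2-p}$. Here $\varepsilon=[\varepsilon_-,\varepsilon_+]$ with $0<\varepsilon_-\le\varepsilon_+<\infty$ is a fixed relaxation interval, $v_0\in W_0^{1,2}(\Omega)$ is arbitrary, and $v_{n+1}\in W_0^{1,2}(\Omega)$ is recursively calculated from $v_n$ by $$\int_\Omega(\varepsilon_-\vee|\nabla v_n|\wedge\varepsilon_+)^{p-2}\,\nabla v_{n+1}\cdot\nabla\xi\,dx=\langle f,\xi\rangle\qquad\text{for all }\xi\in W_0^{1,2}(\Omega).$$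
   Context: Standing setting: $\Omega\subset\mathbb R^d$ is open and bounded, $1<p<2$, $f\in (W_0^{1,p}(\Omega))^*$. Notation: $\varepsilon_-\vee t\wedge\varepsilon_+:=\max\{\varepsilon_-,\min\{t,\varepsilon_+\}\}$. For $\varepsilon=[\varepsilon_-,\varepsilon_+]$ with $0<\varepsilon_-\le\varepsilon_+<\infty$ define $$\kappa_\varepsilon(t):=\begin{cases}\frac12\varepsilon_-^{p-2}t^2+(\frac1p-\frac12)\varepsilon_-^p & t\le\varepsilon_-,\\ \frac1p t^p & \varepsilon_-\le t\le\varepsilon_+,\\ \frac12\varepsilon_+^{p-2}t^2+(\frac1p-\frac12)\varepsilon_+^p & t\ge\varepsilon_+,\end{cases}$$ and $\mathcal J_\varepsilon(v):=\int_\Omega\kappa_\varepsilon(|\nabla v|)\,dx-\langle f,v\rangle$. The functional $\mathcal J_\varepsilon$ is finite exactly on $W_0^{1,2}(\Omega)$ and $u_\varepsilon$ denotes its unique minimizer. *)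

theory Defs
  imports "HOL-Analysis.Analysis"
begin

section \<open>Sobolev spaces with zero boundary values\<close>

primrec Ck :: "nat \<Rightarrow> ('a::euclidean_space \<Rightarrow> real) \<Rightarrow> bool" where
  "Ck 0 f \<longleftrightarrow> continuous_on UNIV f"
| "Ck (Suc k) f \<longleftrightarrow> (\<forall>x. f differentiable (at x)) \<and>
     (\<forall>i\<in>Basis. Ck k (\<lambda>x. frechet_derivative f (at x) i))"

definition test_functions :: "'a::euclidean_space set \<Rightarrow> ('a \<Rightarrow> real) set" where
  "test_functions \<Omega> = {\<phi>. (\<forall>k. Ck k \<phi>) \<and>
     compact (closure {x. \<phi> x \<noteq> 0}) \<and> closure {x. \<phi> x \<noteq> 0} \<subseteq> \<Omega>}"

definition classical_grad :: "('a::euclidean_space \<Rightarrow> real) \<Rightarrow> 'a \<Rightarrow> 'a" where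
  "classical_grad \<phi> x = (\<Sum>i\<in>Basis. frechet_derivative \<phi> (at x) i *\<^sub>R i)"

definition locally_integrable ::
  "'a::euclidean_space set \<Rightarrow> ('a \<Rightarrow> 'b::euclidean_space) \<Rightarrow> bool" where
  "locally_integrable \<Omega> u \<longleftrightarrow>
     (\<forall>K. compact K \<and> K \<subseteq> \<Omega> \<longrightarrow> integrable (lebesgue_on K) u)"

definition has_weak_grad ::
  "'a::euclidean_space set \<Rightarrow> ('a \<Rightarrow> real) \<Rightarrow> ('a \<Rightarrow> 'a) \<Rightarrow> bool" where
  "has_weak_grad \<Omega> u g \<longleftrightarrow> locally_integrable \<Omega> u \<and> locally_integrable \<Omega> g \<and>
     (\<forall>\<phi>\<in>test_functions \<Omega>.
        (\<integral>x. u x *\<^sub>R classical_grad \<phi> x \<partial>lebesgue_on \<Omega>) =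
        - (\<integral>x. \<phi> x *\<^sub>R g x \<partial>lebesgue_on \<Omega>))"

text \<open>A representative of the weak gradient, which is unique up to null sets. Here and below
  functions are total and stand for their equivalence classes modulo equality almost everywhere
  on \<open>\<Omega>\<close>; their values outside \<open>\<Omega>\<close> are irrelevant.\<close>

definition weak_grad :: "'a::euclidean_space set \<Rightarrow> ('a \<Rightarrow> real) \<Rightarrow> 'a \<Rightarrow> 'a" where
  "weak_grad \<Omega> u = (SOME g. has_weak_grad \<Omega> u g)"

definition Lp :: "real \<Rightarrow> 'a::euclidean_space set \<Rightarrow> ('a \<Rightarrow> 'b::euclidean_space) set" where
  "Lp p \<Omega> = {u \<in> borel_measurable (lebesgue_on \<Omega>).
     integrable (lebesgue_on \<Omega>) (\<lambda>x. norm (u x) powr p)}"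

definition sobolev :: "real \<Rightarrow> 'a::euclidean_space set \<Rightarrow> ('a \<Rightarrow> real) set" where
  "sobolev p \<Omega> = {u \<in> Lp p \<Omega>. \<exists>g \<in> Lp p \<Omega>. has_weak_grad \<Omega> u g}"

definition sobolev_norm :: "real \<Rightarrow> 'a::euclidean_space set \<Rightarrow> ('a \<Rightarrow> real) \<Rightarrow> real" where
  "sobolev_norm p \<Omega> u =
     ((\<integral>x. \<bar>u x\<bar> powr p \<partial>lebesgue_on \<Omega>) +
      (\<integral>x. norm (weak_grad \<Omega> u x) powr p \<partial>lebesgue_on \<Omega>)) powr (1 / p)"

definition sobolev0 :: "real \<Rightarrow> 'a::euclidean_space set \<Rightarrow> ('a \<Rightarrow> real) set" where
  "sobolev0 p \<Omega> = {u \<in> sobolev p \<Omega>.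
     \<exists>\<phi>. (\<forall>n::nat. \<phi> n \<in> test_functions \<Omega>) \<and>
         (\<lambda>n. sobolev_norm p \<Omega> (\<lambda>x. \<phi> n x - u x)) \<longlonglongrightarrow> 0}"

text \<open>Functionals act on representatives. Boundedness together with linearity forces them to
  depend only on the equivalence class.\<close>

definition sobolev0_dual ::
  "real \<Rightarrow> 'a::euclidean_space set \<Rightarrow> (('a \<Rightarrow> real) \<Rightarrow> real) set" where
  "sobolev0_dual p \<Omega> = {F.
     (\<forall>u\<in>sobolev0 p \<Omega>. \<forall>v\<in>sobolev0 p \<Omega>. F (\<lambda>x. u x + v x) = F u + F v) \<and>
     (\<forall>c. \<forall>u\<in>sobolev0 p \<Omega>. F (\<lambda>x. c * u x) = c * F u) \<and>
     (\<exists>C. \<forall>u\<in>sobolev0 p \<Omega>. \<bar>F u\<bar> \<le> C * sobolev_norm p \<Omega> u)}"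

section \<open>The relaxed energy\<close>

definition clamp_between :: "real \<Rightarrow> real \<Rightarrow> real \<Rightarrow> real" where
  "clamp_between em ep t = max em (min t ep)"

definition kappa :: "real \<Rightarrow> real \<Rightarrow> real \<Rightarrow> real \<Rightarrow> real" where
  "kappa p em ep t =
     (if t \<le> em then 1/2 * em powr (p - 2) * t\<^sup>2 + (1/p - 1/2) * em powr p
      else if t \<le> ep then 1/p * t powr p
      else 1/2 * ep powr (p - 2) * t\<^sup>2 + (1/p - 1/2) * ep powr p)"

text \<open>Only meaningful for \<open>v \<in> sobolev0 2 \<Omega>\<close>: outside that space the functional is to be
  thought of as infinite, so it must be minimised over \<open>sobolev0 2 \<Omega>\<close>.\<close>

definition relaxed_energy ::
  "real \<Rightarrow> 'a::euclidean_space set \<Rightarrow> (('a \<Rightarrow> real) \<Rightarrow> real) \<Rightarrow> real \<Rightarrow> real \<Rightarrow>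
   ('a \<Rightarrow> real) \<Rightarrow> real" where
  "relaxed_energy p \<Omega> f em ep v =
     (\<integral>x. kappa p em ep (norm (weak_grad \<Omega> v x)) \<partial>lebesgue_on \<Omega>) - f v"

end

theory Submission
  imports Defs
begin

text \<open>Write \<open>a(t)\<close> for the clamped weight, so that \<open>\<kappa>'(t) = a(t) t\<close>. Because \<open>a\<close> is decreasing,
  the quadratic with second derivative \<open>a(t)\<close> touching \<open>\<kappa>\<close> at \<open>t\<close> lies above \<open>\<kappa>\<close>; the next iterate
  minimises the functional frozen in this way, so a step lowers the energy by at least
  \<open>\<integral> a |\<nabla>(v\<^sub>n - v')|\<^sup>2 / 2\<close>, where \<open>v'\<close> is the successor of \<open>v\<^sub>n\<close>. Conversely
  \<open>\<kappa>(|\<cdot>|)\<close> is strongly convex with modulus \<open>(p - 1) a(\<epsilon>\<^sub>+)\<close>, and Young's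
  inequality bounds the energy error of \<open>v\<^sub>n\<close> by \<open>1/\<delta>\<close> times the same integral, with
  \<open>c\<^sub>K = 1/(p - 1)\<close>. Since \<open>weak_grad\<close> is chosen by \<open>SOME\<close>, its square integrability rests on
  the almost everywhere uniqueness of weak gradients, which needs enough test functions.\<close>

section \<open>Smooth bump functions\<close>

text \<open>Carrying a polynomial factor \<open>P\<close> in 1/t makes this family of flat functions
  closed under differentiation, so smoothness becomes one induction over the order.\<close>

definition flat_exp :: "real poly \<Rightarrow> real \<Rightarrow> real" where
  "flat_exp P t = (if t \<le> 0 then 0 else poly P (1 / t) * exp (- (1 / t)))"

text \<open>With s = 1/t, the rule d/dt = -s^2 d/ds turns P(s) exp(-s) into s^2 (P - P')(s) exp(-s);
  \<open>[:0, 0, 1:]\<close> is s^2.\<close>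

definition flat_exp_deriv :: "real poly \<Rightarrow> real poly" where
  "flat_exp_deriv P = [:0, 0, 1:] * (P - pderiv P)"

text \<open>The free exponent \<open>k\<close> absorbs the factor \<open>s\<close> that each
  \<open>pCons\<close> splits off: the induction hypothesis is used at \<open>Suc k\<close>.\<close>

lemma tendsto_poly_div_exp_0: "((\<lambda>s. s ^ k * poly P s / exp s) \<longlongrightarrow> (0::real)) at_top"
proof (induction P arbitrary: k)
  case 0
  then show ?case by simp
next
  case (pCons a P)
  have "((\<lambda>s. a * (s ^ k / exp s) + s ^ Suc k * poly P s / exp s) \<longlongrightarrow> a * 0 + 0) at_top"
    by (intro tendsto_intros tendsto_power_div_exp_0 pCons.IH)
  then show ?case by (simp add: field_simps)
qed

lemma flat_exp_has_derivative:
  "(flat_exp P has_real_derivative flat_exp (flat_exp_deriv P) t) (at t)"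
proof -
  consider "t < 0" | "t = 0" | "t > 0" by linarith
  then show ?thesis
  proof cases
    case 1
    have "((\<lambda>_. 0) has_real_derivative flat_exp (flat_exp_deriv P) t) (at t)"
      using 1 by (simp add: flat_exp_def)
    moreover have ev: "eventually (\<lambda>s. 0 = flat_exp P s) (nhds t)"
      using eventually_nhds_in_open[of "{..<0}" t] 1
      by (auto elim!: eventually_mono simp: flat_exp_def)
    ultimately show ?thesis
      using DERIV_cong_ev[OF refl ev refl] by blast
  next
    case 2
    \<comment> \<open>At 0 the right difference quotient is s P(s) / exp(s) with s = 1/h; the
      exponent 1 is the division by h.\<close>
    have "((\<lambda>s. s ^ 1 * poly P s / exp s) \<longlongrightarrow> 0) at_top"
      by (rule tendsto_poly_div_exp_0)
    then have "((\<lambda>h. inverse h ^ 1 * poly P (inverse h) / exp (inverse h)) \<longlongrightarrow> 0) (at_right (0::real))"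
      by (rule filterlim_compose[OF _ filterlim_inverse_at_top_right])
    then have R: "((\<lambda>h. (flat_exp P (0 + h) - flat_exp P 0) / h) \<longlongrightarrow> 0) (at_right 0)"
      by (rule Lim_transform_eventually)
        (auto simp: flat_exp_def eventually_at_filter field_simps exp_minus)
    have "((\<lambda>h. 0) \<longlongrightarrow> (0::real)) (at_left (0::real))" by simp
    then have L: "((\<lambda>h. (flat_exp P (0 + h) - flat_exp P 0) / h) \<longlongrightarrow> 0) (at_left 0)"
      by (rule Lim_transform_eventually) (auto simp: flat_exp_def eventually_at_filter)
    show ?thesis
      using filterlim_split_at[OF L R] 2 by (simp add: DERIV_def flat_exp_def)
  next
    case 3
    have "((\<lambda>t. poly P (1 / t) * exp (- (1 / t))) has_real_derivative
        flat_exp (flat_exp_deriv P) t) (at t)"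
      using 3 unfolding flat_exp_def flat_exp_deriv_def
      by (auto intro!: derivative_eq_intros DERIV_chain'[OF _ poly_DERIV]
          simp: field_simps power2_eq_square)
    moreover have ev: "eventually (\<lambda>s. poly P (1 / s) * exp (- (1 / s)) = flat_exp P s) (nhds t)"
      using eventually_nhds_in_open[of "{0<..}" t] 3
      by (auto elim!: eventually_mono simp: flat_exp_def)
    ultimately show ?thesis
      using DERIV_cong_ev[OF refl ev refl] by blast
  qed
qed

section \<open>Calculus of \<open>Ck\<close> functions\<close>

lemma Ck_Suc_imp: "Ck (Suc k) f \<Longrightarrow> Ck k f"
proof (induction k arbitrary: f)
  case 0
  then show ?case
    by (auto simp: continuous_on_eq_continuous_at differentiable_imp_continuous_within)
next
  case (Suc k)
  then show ?case by (metis Ck.simps(2))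
qed

lemma Ck_const: "Ck k (\<lambda>x. c)"
proof (induction k arbitrary: c)
  case (Suc k)
  then show ?case by (simp add: frechet_derivative_const)
qed simp

lemma Ck_add: "Ck k f \<Longrightarrow> Ck k g \<Longrightarrow> Ck k (\<lambda>x. f x + g x)"
proof (induction k arbitrary: f g)
  case 0
  then show ?case by (auto intro!: continuous_intros)
next
  case (Suc k)
  have "frechet_derivative (\<lambda>x. f x + g x) (at x) =
     (\<lambda>h. frechet_derivative f (at x) h + frechet_derivative g (at x) h)" for x
    using Suc.prems
    by (intro frechet_derivative_at[symmetric] has_derivative_add)
       (auto simp flip: frechet_derivative_works)
  then show ?case using Suc by auto
qed

lemma Ck_mult: "Ck k f \<Longrightarrow> Ck k g \<Longrightarrow> Ck k (\<lambda>x. f x * g x)"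
proof (induction k arbitrary: f g)
  case 0
  then show ?case by (auto intro!: continuous_intros)
next
  case (Suc k)
  have D: "frechet_derivative (\<lambda>x. f x * g x) (at x) =
     (\<lambda>h. f x * frechet_derivative g (at x) h + frechet_derivative f (at x) h * g x)" for x
    using Suc.prems
    by (intro frechet_derivative_at[symmetric] has_derivative_mult)
       (auto simp flip: frechet_derivative_works)
  \<comment> \<open>The product rule leaves one factor undifferentiated, and the induction
    hypothesis needs that factor at order \<open>k\<close>.\<close>
  have "Ck k f" "Ck k g"
    using Suc.prems Ck_Suc_imp by blast+
  then show ?case
    using Suc by (auto simp: D intro!: Ck_add)
qed

lemma Ck_prod: "(\<And>i. i \<in> I \<Longrightarrow> Ck k (f i)) \<Longrightarrow> Ck k (\<lambda>x. \<Prod>i\<in>I. f i x)"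
  by (induction I rule: infinite_finite_induct) (auto intro: Ck_const Ck_mult)

text \<open>A partial derivative only replaces \<open>P\<close> by \<open>flat_exp_deriv P\<close>
  and multiplies by a constant, so the induction runs with \<open>P\<close> arbitrary.\<close>

lemma Ck_flat_exp: "Ck k (\<lambda>x. flat_exp P (x \<bullet> w + c))"
proof (induction k arbitrary: P)
  case 0
  have "isCont (flat_exp P) t" for t
    using flat_exp_has_derivative DERIV_isCont by blast
  then have "continuous_on UNIV (flat_exp P)"
    by (simp add: continuous_on_eq_continuous_at)
  then show ?case
    by (auto intro!: continuous_on_compose2[of UNIV "flat_exp P"] continuous_intros)
next
  case (Suc k)
  have D: "((\<lambda>x. flat_exp P (x \<bullet> w + c)) has_derivative
      (\<lambda>h. flat_exp (flat_exp_deriv P) (x \<bullet> w + c) * (h \<bullet> w))) (at x)" for x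
    by (rule has_derivative_eq_rhs, rule has_derivative_compose[of "\<lambda>x. x \<bullet> w + c",
        OF _ flat_exp_has_derivative[unfolded has_field_derivative_def]])
      (auto intro!: derivative_eq_intros)
  have "frechet_derivative (\<lambda>x. flat_exp P (x \<bullet> w + c)) (at x) =
      (\<lambda>h. flat_exp (flat_exp_deriv P) (x \<bullet> w + c) * (h \<bullet> w))" for x
    using frechet_derivative_at[OF D] by simp
  then show ?case
    using D by (auto simp: differentiable_def intro!: Ck_mult Ck_const Suc)
qed

text \<open>As \<open>n\<close> grows these converge to the indicator of the open box, since \<open>exp (-1/(n t))\<close> tends to 1.\<close>
definition box_bump :: "'a::euclidean_space \<Rightarrow> 'a \<Rightarrow> nat \<Rightarrow> 'a \<Rightarrow> real" where
  "box_bump a b n x = (\<Prod>i\<in>Basis. flat_exp 1 (x \<bullet> (real n *\<^sub>R i) + - (real n * (a \<bullet> i))) *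
     flat_exp 1 (x \<bullet> (- (real n *\<^sub>R i)) + real n * (b \<bullet> i)))"

lemma box_bump_outside: "x \<notin> box a b \<Longrightarrow> box_bump a b n x = 0"
proof -
  assume "x \<notin> box a b"
  then obtain i where i: "i \<in> Basis" "x \<bullet> i \<le> a \<bullet> i \<or> b \<bullet> i \<le> x \<bullet> i"
    by (auto simp: box_def not_less)
  then have "flat_exp 1 (x \<bullet> (real n *\<^sub>R i) + - (real n * (a \<bullet> i))) *
      flat_exp 1 (x \<bullet> (- (real n *\<^sub>R i)) + real n * (b \<bullet> i)) = 0"
    by (auto simp: flat_exp_def mult_left_mono)
  then show ?thesis
    unfolding box_bump_def using i(1) by (intro prod_zero) auto
qed

lemma flat_exp_1_bounds: "0 \<le> flat_exp 1 t" "flat_exp 1 t \<le> 1"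
  by (auto simp: flat_exp_def)

lemma box_bump_nonneg: "0 \<le> box_bump a b n x"
  unfolding box_bump_def by (intro prod_nonneg mult_nonneg_nonneg flat_exp_1_bounds)

lemma box_bump_le_1: "box_bump a b n x \<le> 1"
  unfolding box_bump_def
  by (intro prod_le_1 conjI mult_nonneg_nonneg mult_le_one flat_exp_1_bounds)

lemma box_bump_tendsto: "(\<lambda>n. box_bump a b n x) \<longlonglongrightarrow> indicator (box a b) x"
proof (cases "x \<in> box a b")
  case True
  have flat: "(\<lambda>n. flat_exp 1 (real n * s)) \<longlonglongrightarrow> 1" if "s > 0" for s
  proof (rule Lim_transform_eventually)
    have "(\<lambda>n. exp (- (inverse (real n) * (1 / s)))) \<longlonglongrightarrow> exp (- (0 * (1 / s)))"
      by (intro tendsto_intros lim_inverse_n)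
    then show "(\<lambda>n. exp (- (inverse (real n) * (1 / s)))) \<longlonglongrightarrow> 1" by simp
    show "\<forall>\<^sub>F n in sequentially. exp (- (inverse (real n) * (1 / s))) = flat_exp 1 (real n * s)"
      using eventually_gt_at_top[of 0]
      by eventually_elim (use that in \<open>auto simp: flat_exp_def field_simps mult_le_0_iff\<close>)
  qed
  have "(\<lambda>n. \<Prod>i\<in>Basis. flat_exp 1 (real n * (x \<bullet> i - a \<bullet> i)) * flat_exp 1 (real n * (b \<bullet> i - x \<bullet> i)))
      \<longlonglongrightarrow> (\<Prod>i\<in>(Basis::'a set). 1 * 1)"
    using True by (intro tendsto_prod tendsto_mult flat) (auto simp: box_def)
  then show ?thesis
    using True by (simp add: box_bump_def algebra_simps)
next
  case False
  then show ?thesis by (simp add: box_bump_outside)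
qed

lemma box_bump_test_function:
  assumes "cbox a b \<subseteq> \<Omega>"
  shows "box_bump a b n \<in> test_functions \<Omega>"
proof -
  have "{x. box_bump a b n x \<noteq> 0} \<subseteq> cbox a b"
    using box_bump_outside box_subset_cbox by blast
  then have "closure {x. box_bump a b n x \<noteq> 0} \<subseteq> cbox a b"
    by (intro closure_minimal closed_cbox)
  moreover have "Ck k (box_bump a b n)" for k
    unfolding box_bump_def by (intro Ck_prod Ck_mult Ck_flat_exp)
  ultimately show ?thesis
    using assms
    by (auto simp: test_functions_def compact_eq_bounded_closed intro: bounded_subset[OF bounded_cbox])
qed

section \<open>The relaxed integrand\<close>

text \<open>The closures of the two half-lines meet only at \<open>c\<close>, where both branches
  have derivative \<open>D\<close> and equal values. This handles the break points of
  \<open>kappa\<close>.\<close>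

lemma has_real_derivative_If_le:
  assumes "t \<le> c \<Longrightarrow> (g has_real_derivative D) (at t)"
    and "c \<le> t \<Longrightarrow> (h has_real_derivative D) (at t)" and "g c = h c"
  shows "((\<lambda>s. if s \<le> c then g s else h s) has_real_derivative D) (at t)"
proof -
  have "((\<lambda>s. if s \<in> {..c} then g s else h s) has_derivative
      (if t \<in> {..c} then (*) D else (*) D)) (at t within {..c} \<union> {c<..})"
    using assms
    by (intro has_derivative_If_within_closures)
      (auto simp: has_field_derivative_def intro: has_derivative_at_withinI)
  moreover have "{..c} \<union> {c<..} = UNIV" by auto
  ultimately show ?thesis
    by (simp add: has_field_derivative_def)
qed

context
  fixes p em ep :: real
  assumes p: "1 < p" "p < 2" and em: "0 < em" and le: "em \<le> ep"
begin

abbreviation (input) "weight t \<equiv> clamp_between em ep t powr (p - 2)"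

section \<open>The clamped weight and the derivative of \<open>kappa\<close>\<close>

lemma clamp_between_bounds: "em \<le> clamp_between em ep t" "clamp_between em ep t \<le> ep"
  using le by (auto simp: clamp_between_def)

lemma weight_le: "weight t \<le> em powr (p - 2)"
  using clamp_between_bounds[of t] em p by (intro powr_mono2') auto

lemma weight_ge: "ep powr (p - 2) \<le> weight t"
  using clamp_between_bounds[of t] em p by (intro powr_mono2') auto

lemma weight_antimono: "s \<le> t \<Longrightarrow> weight t \<le> weight s"
  using em p le by (intro powr_mono2') (auto simp: clamp_between_def)

text \<open>The additive constants in \<open>kappa\<close> make neighbouring pieces agree at
  \<open>em\<close> and \<open>ep\<close>; their slopes agree there as well, so the pieces glue to a
  differentiable function.\<close>

lemma kappa_has_derivative: "(kappa p em ep has_real_derivative weight t * t) (at t)"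
  unfolding kappa_def
proof (rule has_real_derivative_If_le, goal_cases)
  case 1
  then show ?case using em le
    by (auto intro!: derivative_eq_intros simp: clamp_between_def)
next
  case 2
  show ?case
  proof (rule has_real_derivative_If_le, goal_cases)
    case 1
    then show ?case using 2 em le p
      by (auto intro!: derivative_eq_intros simp: clamp_between_def powr_diff power2_eq_square)
  next
    case 2
    then show ?case using em le
      by (auto intro!: derivative_eq_intros simp: clamp_between_def max_def)
  next
    case 3
    then show ?case using em le
      by (simp add: field_simps powr_diff)
  qed
next
  case 3
  then show ?case using em le
    by (auto simp: field_simps powr_diff)
qed

section \<open>Quadratic bounds for \<open>kappa\<close> from above and below\<close>

text \<open>Subtracting the quadratic leaves a function with derivative
  \<open>(weight r - weight t) * r\<close>. Since the weight decreases, this is nonnegative before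
  \<open>t\<close> and nonpositive after it, so \<open>t\<close> is a maximum on the
  half-line.\<close>

lemma kappa_le_quadratic:
  assumes "0 \<le> t" "0 \<le> s"
  shows "kappa p em ep s \<le> kappa p em ep t + weight t / 2 * (s\<^sup>2 - t\<^sup>2)"
proof -
  define D where "D s = kappa p em ep s - weight t / 2 * s\<^sup>2" for s
  have D': "(D has_real_derivative (weight r - weight t) * r) (at r)" for r
    unfolding D_def
    by (auto intro!: derivative_eq_intros kappa_has_derivative simp: algebra_simps)
  have "D s \<le> D t"
  proof (cases "s \<le> t")
    case True
    show ?thesis
    proof (rule DERIV_nonneg_imp_nondecreasing[OF True])
      fix r assume "s \<le> r" "r \<le> t"
      then have "0 \<le> (weight r - weight t) * r"
        using weight_antimono[of r t] assms by auto
      then show "\<exists>y. (D has_real_derivative y) (at r) \<and> 0 \<le> y" using D' by blast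
    qed
  next
    case False
    then have "t \<le> s" by simp
    show ?thesis
    proof (rule DERIV_nonpos_imp_nonincreasing[OF \<open>t \<le> s\<close>])
      fix r assume "t \<le> r" "r \<le> s"
      then have "(weight r - weight t) * r \<le> 0"
        using weight_antimono[of t r] assms by (auto intro: mult_nonpos_nonneg)
      then show "\<exists>y. (D has_real_derivative y) (at r) \<and> y \<le> 0" using D' by blast
    qed
  qed
  then show ?thesis by (simp add: D_def field_simps)
qed

text \<open>The constant \<open>(p - 1) * ep powr (p - 2)\<close> bounds every slope of the flux
  \<open>weight t * t\<close> from below: the middle piece has slope
  \<open>(p - 1) * t powr (p - 2)\<close> with \<open>t \<le> ep\<close>, and the outer pieces have
  slope at least \<open>ep powr (p - 2)\<close>.\<close>

lemma weight_flux_strongly_mono: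
  assumes "0 \<le> s" "s \<le> t"
  shows "(weight s - (p - 1) * ep powr (p - 2)) * s \<le> (weight t - (p - 1) * ep powr (p - 2)) * t"
    (is "?E s \<le> ?E t")
proof -
  define m where "m = (p - 1) * ep powr (p - 2)"
  have m: "m \<le> ep powr (p - 2)" "0 \<le> m"
    using p mult_right_mono[of "p - 1" 1 "ep powr (p - 2)"] by (auto simp: m_def)
  \<comment> \<open>\<open>mono\<close> serves the two linear pieces of the flux and
    \<open>mid\<close> the power piece; the cases below chain them through the break points.\<close>
  have mono: "?E a \<le> ?E b" if "0 \<le> a" "a \<le> b" "weight a = weight b" for a b
    using that m weight_ge[of a] by (auto simp: m_def[symmetric] intro!: mult_left_mono)
  have mid: "?E a \<le> ?E b" if "em \<le> a" "a \<le> b" "b \<le> ep" for a b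
  proof -
    have "a powr (p - 1) - m * a \<le> b powr (p - 1) - m * b"
    proof (rule DERIV_nonneg_imp_nondecreasing[OF that(2)])
      fix x assume "a \<le> x" "x \<le> b"
      then have x: "0 < x" "x \<le> ep" using that em by auto
      then have "ep powr (p - 2) \<le> x powr (p - 2)"
        using p by (intro powr_mono2') auto
      then have "0 \<le> (p - 1) * x powr (p - 2) - m"
        using p by (simp add: m_def)
      moreover have "((\<lambda>x. x powr (p - 1) - m * x) has_real_derivative
          (p - 1) * x powr (p - 2) - m) (at x)"
        using x by (auto intro!: derivative_eq_intros has_real_derivative_powr
            )
      ultimately show "\<exists>y. ((\<lambda>x. x powr (p - 1) - m * x) has_real_derivative y) (at x) \<and> 0 \<le> y"
        by blast
    qed
    moreover have "weight c * c = c powr (p - 1)" if "em \<le> c" "c \<le> ep" for c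
      using that em by (simp add: clamp_between_def powr_diff power2_eq_square)
    ultimately show ?thesis using that by (simp add: m_def algebra_simps)
  qed
  consider "s \<le> em" "t \<le> em" | "s \<le> em" "em \<le> t" "t \<le> ep" | "s \<le> em" "ep \<le> t"
    | "em \<le> s" "t \<le> ep" | "em \<le> s" "s \<le> ep" "ep \<le> t" | "ep \<le> s"
    using assms by linarith
  then show ?thesis
  proof cases
    case 1
    then show ?thesis using assms by (intro mono) (auto simp: clamp_between_def)
  next
    case 2
    then have "?E s \<le> ?E em" using assms le by (intro mono) (auto simp: clamp_between_def)
    also have "\<dots> \<le> ?E t" using 2 by (intro mid) auto
    finally show ?thesis .
  next
    case 3
    then have "?E s \<le> ?E em" using assms le by (intro mono) (auto simp: clamp_between_def)
    also have "\<dots> \<le> ?E ep" using le by (intro mid) auto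
    also have "\<dots> \<le> ?E t" using 3 em le by (intro mono) (auto simp: clamp_between_def)
    finally show ?thesis .
  next
    case 4
    then show ?thesis using assms by (intro mid) auto
  next
    case 5
    then have "?E s \<le> ?E ep" by (intro mid) auto
    also have "\<dots> \<le> ?E t" using 5 em le by (intro mono) (auto simp: clamp_between_def)
    finally show ?thesis .
  next
    case 6
    then show ?thesis using assms by (intro mono) (auto simp: clamp_between_def)
  qed
qed

text \<open>The gap between the two sides, as a function of \<open>s\<close>, has the increment of
  the shifted flux from \<open>t\<close> as its derivative. By monotonicity this changes sign from
  minus to plus at \<open>t\<close>, so the gap is minimal there.\<close>

lemma kappa_strongly_convex_real:
  assumes "0 \<le> t" "0 \<le> s"
  shows "kappa p em ep t + weight t * t * (s - t) + (p - 1) * ep powr (p - 2) / 2 * (s - t)\<^sup>2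
    \<le> kappa p em ep s"
proof -
  define m where "m = (p - 1) * ep powr (p - 2)"
  define D where "D r = kappa p em ep r - m / 2 * r\<^sup>2 - (weight t - m) * t * r" for r
  have D': "(D has_real_derivative (weight r - m) * r - (weight t - m) * t) (at r)" for r
    unfolding D_def
    by (auto intro!: derivative_eq_intros kappa_has_derivative simp: algebra_simps)
  have "D t \<le> D s"
  proof (cases "t \<le> s")
    case True
    show ?thesis
    proof (rule DERIV_nonneg_imp_nondecreasing[OF True])
      fix r assume "t \<le> r" "r \<le> s"
      then have "0 \<le> (weight r - m) * r - (weight t - m) * t"
        using weight_flux_strongly_mono[of t r] assms by (auto simp: m_def)
      then show "\<exists>y. (D has_real_derivative y) (at r) \<and> 0 \<le> y" using D' by blast
    qed
  next
    case False
    then have "s \<le> t" by simp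
    show ?thesis
    proof (rule DERIV_nonpos_imp_nonincreasing[OF \<open>s \<le> t\<close>])
      fix r assume "s \<le> r" "r \<le> t"
      then have "(weight r - m) * r - (weight t - m) * t \<le> 0"
        using weight_flux_strongly_mono[of r t] assms by (auto simp: m_def)
      then show "\<exists>y. (D has_real_derivative y) (at r) \<and> y \<le> 0" using D' by blast
    qed
  qed
  then show ?thesis
    unfolding m_def[symmetric] by (simp add: D_def field_simps power2_eq_square)
qed

text \<open>Passing from norms to vectors costs
  \<open>(weight (norm x) - m) * (norm x * norm y - x \<bullet> y)\<close>, which has the right sign
  by Cauchy-Schwarz because \<open>m\<close> is at most the weight.\<close>

lemma kappa_strongly_convex:
  fixes x y :: "'b::real_inner"
  shows "kappa p em ep (norm x) + weight (norm x) * (x \<bullet> (y - x)) +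
      (p - 1) * ep powr (p - 2) / 2 * (norm (y - x))\<^sup>2 \<le> kappa p em ep (norm y)"
proof -
  define m where "m = (p - 1) * ep powr (p - 2)"
  have "m \<le> weight (norm x)"
    using p mult_right_mono[of "p - 1" 1 "ep powr (p - 2)"] weight_ge[of "norm x"]
    by (auto simp: m_def)
  then have c: "(weight (norm x) - m) * (x \<bullet> y) \<le> (weight (norm x) - m) * (norm x * norm y)"
    by (intro mult_left_mono norm_cauchy_schwarz) auto
  have e1: "(norm (y - x))\<^sup>2 = (norm y)\<^sup>2 + (norm x)\<^sup>2 - 2 * (x \<bullet> y)"
    by (simp add: power2_norm_eq_inner inner_diff_left inner_diff_right inner_commute)
  have e2: "x \<bullet> (y - x) = x \<bullet> y - (norm x)\<^sup>2"
    by (simp add: power2_norm_eq_inner inner_diff_right)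
  define q where "q = x \<bullet> y"
  have "kappa p em ep (norm x) + weight (norm x) * (x \<bullet> (y - x)) + m / 2 * (norm (y - x))\<^sup>2 =
      kappa p em ep (norm x) + weight (norm x) * norm x * (norm y - norm x) +
      m / 2 * (norm y - norm x)\<^sup>2 - ((weight (norm x) - m) * (norm x * norm y) - (weight (norm x) - m) * (x \<bullet> y))"
    unfolding e1 e2 q_def[symmetric] by algebra
  also have "\<dots> \<le> kappa p em ep (norm y)"
    using c kappa_strongly_convex_real[of "norm x" "norm y"] unfolding m_def[symmetric] by simp
  finally show ?thesis by (simp add: m_def)
qed

text \<open>With \<open>x\<close>, \<open>y\<close>, \<open>z\<close> the gradients of \<open>v\<^sub>n\<close>, its successor and the minimizer \<open>u\<close>, the sides
  integrate to \<open>\<delta> (J v\<^sub>n - J u)\<close> and to the energy decrease of one step. Half the weighted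
  square of \<open>y - x\<close> lies between them.\<close>
lemma kacanov_pointwise:
  fixes x y z :: "'b::real_inner"
  shows "(p - 1) * (em / ep) powr (2 - p) *
      (kappa p em ep (norm x) - kappa p em ep (norm z) - weight (norm x) * (y \<bullet> x) + weight (norm x) * (y \<bullet> z))
    \<le> kappa p em ep (norm x) - kappa p em ep (norm y) - weight (norm x) * (y \<bullet> x) + weight (norm x) * (y \<bullet> y)"
    (is "?d * ?L \<le> ?R")
proof -
  define a where "a = weight (norm x)"
  define m where "m = (p - 1) * ep powr (p - 2)"
  have m: "m > 0" using p em le by (simp add: m_def)
  have d: "?d > 0" using p em le by simp
  \<comment> \<open>This is the origin of \<delta>: it is exactly the convexity modulus
    \<open>m\<close> divided by the largest weight \<open>em powr (p - 2)\<close>.\<close>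
  have da: "?d * a \<le> m"
  proof -
    have "?d * a \<le> ?d * em powr (p - 2)"
      using weight_le[of "norm x"] d by (intro mult_left_mono) (auto simp: a_def)
    also have "\<dots> = m"
      using em le by (simp add: m_def powr_divide powr_diff field_simps power2_eq_square)
    finally show ?thesis .
  qed
  have "?L \<le> a * ((y - x) \<bullet> (z - x)) - m / 2 * (norm (z - x))\<^sup>2"
    using kappa_strongly_convex[of x z]
    unfolding a_def[symmetric] m_def[symmetric] by (simp add: algebra_simps inner_commute)
  also have "\<dots> \<le> a\<^sup>2 / (2 * m) * (norm (y - x))\<^sup>2"
  proof -
    \<comment> \<open>Young's inequality with the weights that cancel the term
      \<open>m / 2 * (norm (z - x))\<^sup>2\<close> exactly.\<close>
    have "0 \<le> (norm (a *\<^sub>R (y - x) - m *\<^sub>R (z - x)))\<^sup>2" by simp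
    also have "\<dots> = a\<^sup>2 * (norm (y - x))\<^sup>2 + m\<^sup>2 * (norm (z - x))\<^sup>2 - 2 * m * a * ((y - x) \<bullet> (z - x))"
      by (simp only: power2_norm_eq_inner inner_diff_left[of "a *\<^sub>R (y - x)"] inner_diff_right[of _ "a *\<^sub>R (y - x)"]
          inner_scaleR_left inner_scaleR_right inner_commute[of "z - x" "y - x"])
        (simp add: algebra_simps power2_eq_square)
    finally show ?thesis using m by (simp add: field_simps power2_eq_square)
  qed
  finally have "?d * ?L \<le> ?d * (a\<^sup>2 / (2 * m) * (norm (y - x))\<^sup>2)"
    using d by (intro mult_left_mono) auto
  also have "\<dots> = (?d * a) * (a / (2 * m) * (norm (y - x))\<^sup>2)"
    by (simp add: power2_eq_square)
  also have "\<dots> \<le> m * (a / (2 * m) * (norm (y - x))\<^sup>2)"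
    using da m by (intro mult_right_mono) (auto simp: a_def)
  also have "\<dots> = a / 2 * (norm (y - x))\<^sup>2"
    using m by simp
  \<comment> \<open>Inserting the quadratic majorant for \<open>norm y\<close> into
    \<open>?R\<close> completes the square in \<open>y - x\<close>.\<close>
  also have "\<dots> \<le> ?R"
    using kappa_le_quadratic[of "norm x" "norm y"]
    by (simp add: a_def[symmetric] power2_norm_eq_inner inner_diff_left inner_diff_right
        inner_commute[of x y] algebra_simps)
  finally show ?thesis .
qed

lemma kappa_nonneg: "0 \<le> kappa p em ep t"
proof -
  have "0 \<le> 1 / p - 1 / 2" using p by (simp add: field_simps)
  then show ?thesis
    unfolding kappa_def using p by (auto intro!: add_nonneg_nonneg mult_nonneg_nonneg)
qed

text \<open>The majorant touching at 0 gives quadratic growth, hence integrable energies for square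
  integrable gradients on a bounded domain.\<close>

lemma kappa_le: "0 \<le> t \<Longrightarrow> kappa p em ep t \<le> kappa p em ep 0 + em powr (p - 2) / 2 * t\<^sup>2"
  using kappa_le_quadratic[of 0 t] em le by (simp add: clamp_between_def)

lemma kappa_measurable: "kappa p em ep \<in> borel_measurable borel"
  using kappa_has_derivative DERIV_isCont
  by (intro borel_measurable_continuous_onI) (auto simp: continuous_on_eq_continuous_at)

end
section \<open>Uniqueness of weak gradients\<close>

lemma test_function_Ck: "\<phi> \<in> test_functions \<Omega> \<Longrightarrow> Ck k \<phi>"
  unfolding test_functions_def by blast

lemma test_function_continuous: "\<phi> \<in> test_functions \<Omega> \<Longrightarrow> continuous_on S \<phi>"
  using test_function_Ck[of \<phi> \<Omega> 0] continuous_on_subset[of UNIV \<phi> S] by simp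

lemma test_function_measurable:
  "\<phi> \<in> test_functions \<Omega> \<Longrightarrow> S \<in> sets lebesgue \<Longrightarrow> \<phi> \<in> borel_measurable (lebesgue_on S)"
  by (rule continuous_imp_measurable_on_sets_lebesgue[OF test_function_continuous])

text \<open>The test function is bounded and vanishes off a compact subset of \<Omega>, where
  \<open>g\<close> is integrable.\<close>

lemma integrable_test_function_scaleR:
  fixes g :: "'a::euclidean_space \<Rightarrow> 'b::euclidean_space"
  assumes "\<Omega> \<in> sets lebesgue" "locally_integrable \<Omega> g" "\<phi> \<in> test_functions \<Omega>"
  shows "integrable (lebesgue_on \<Omega>) (\<lambda>x. \<phi> x *\<^sub>R g x)"
proof -
  define K where "K = closure {x. \<phi> x \<noteq> 0}"
  have K: "compact K" "K \<subseteq> \<Omega>"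
    using assms(3) by (auto simp: test_functions_def K_def)
  then have [simp]: "K \<in> sets lebesgue"
    by (simp add: borel_compact)
  have g: "integrable (lebesgue_on K) g"
    using assms(2) K by (auto simp: locally_integrable_def)
  have "continuous_on K \<phi>"
    by (rule test_function_continuous[OF assms(3)])
  then have "bounded (\<phi> ` K)"
    using K compact_continuous_image compact_imp_bounded by blast
  then obtain C where C: "\<And>x. x \<in> K \<Longrightarrow> \<bar>\<phi> x\<bar> \<le> C"
    by (auto simp: bounded_iff)
  have [measurable]: "\<phi> \<in> borel_measurable (lebesgue_on K)"
    by (rule test_function_measurable[OF assms(3)]) simp
  have "integrable (lebesgue_on K) (\<lambda>x. \<phi> x *\<^sub>R g x)"
  proof (rule Bochner_Integration.integrable_bound)
    show "integrable (lebesgue_on K) (\<lambda>x. C *\<^sub>R g x)" using g by simp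
    show "(\<lambda>x. \<phi> x *\<^sub>R g x) \<in> borel_measurable (lebesgue_on K)"
      using g by (intro borel_measurable_scaleR) auto
    show "AE x in lebesgue_on K. norm (\<phi> x *\<^sub>R g x) \<le> norm (C *\<^sub>R g x)"
      using C by (intro AE_I2) (auto intro!: mult_right_mono intro: order_trans[OF _ abs_ge_self])
  qed
  then have "integrable lebesgue (\<lambda>x. indicator K x *\<^sub>R \<phi> x *\<^sub>R g x)"
    by (simp add: integrable_restrict_space)
  moreover have "indicat_real K x * \<phi> x = indicat_real \<Omega> x * \<phi> x" for x
    using K(2) closure_subset[of "{x. \<phi> x \<noteq> 0}"] by (auto simp: K_def indicator_def)
  ultimately show ?thesis
    using assms(1) by (simp add: integrable_restrict_space)
qed

text \<open>The bumps converge boundedly to the indicator of the open box, so dominated convergence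
  with majorant \<open>norm (g x)\<close> applies; the boundary of the box does not affect the
  integral.\<close>

lemma integral_cbox_eq_0:
  fixes g :: "'a::euclidean_space \<Rightarrow> 'b::euclidean_space"
  assumes "\<Omega> \<in> sets lebesgue" "locally_integrable \<Omega> g" "cbox a b \<subseteq> \<Omega>"
    and zero: "\<And>\<phi>. \<phi> \<in> test_functions \<Omega> \<Longrightarrow> (\<integral>x. \<phi> x *\<^sub>R g x \<partial>lebesgue_on \<Omega>) = 0"
  shows "integral (cbox a b) g = 0"
proof -
  let ?M = "lebesgue_on (cbox a b)"
  have g: "integrable ?M g"
    using assms by (auto simp: locally_integrable_def)
  note bump = box_bump_test_function[OF assms(3)]
  have restrict: "indicat_real \<Omega> x * box_bump a b n x = indicat_real (cbox a b) x * box_bump a b n x" for n x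
    using assms(3) box_bump_outside[of x a b n] box_subset_cbox[of a b] by (auto simp: indicator_def)
  have "(\<integral>x. box_bump a b n x *\<^sub>R g x \<partial>?M) = 0" for n
    using zero[OF bump, of n] assms(1) by (simp add: integral_restrict_space restrict)
  moreover have "(\<lambda>n. \<integral>x. box_bump a b n x *\<^sub>R g x \<partial>?M)
      \<longlonglongrightarrow> (\<integral>x. indicator (box a b) x *\<^sub>R g x \<partial>?M)"
  proof (rule integral_dominated_convergence)
    show "integrable ?M (\<lambda>x. norm (g x))" using g by simp
    show "(\<lambda>x. indicat_real (box a b) x *\<^sub>R g x) \<in> borel_measurable ?M"
      using g by (intro borel_measurable_scaleR borel_measurable_indicator)
        (auto simp: sets_restrict_space_iff box_subset_cbox)
    show "(\<lambda>x. box_bump a b n x *\<^sub>R g x) \<in> borel_measurable ?M" for n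
      using g test_function_measurable[OF bump] by (intro borel_measurable_scaleR) auto
    show "AE x in ?M. (\<lambda>n. box_bump a b n x *\<^sub>R g x) \<longlonglongrightarrow> indicat_real (box a b) x *\<^sub>R g x"
      by (intro AE_I2 tendsto_scaleR box_bump_tendsto tendsto_const)
    show "AE x in ?M. norm (box_bump a b n x *\<^sub>R g x) \<le> norm (g x)" for n
      using box_bump_nonneg[of a b n] box_bump_le_1[of a b n]
      by (intro AE_I2) (auto intro!: mult_left_le_one_le)
  qed
  ultimately have "(\<integral>x. indicator (box a b) x *\<^sub>R g x \<partial>?M) = 0"
    by (simp add: LIMSEQ_const_iff)
  moreover have "indicat_real (cbox a b) x * indicat_real (box a b) x = indicat_real (box a b) x" for x
    using box_subset_cbox[of a b] by (auto simp: indicator_def)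
  ultimately have 1: "integral\<^sup>L (lebesgue_on (box a b)) g = 0"
    by (simp add: integral_restrict_space)
  \<comment> \<open>Integrability on the open box is what allows the Lebesgue integral to be read as
    a gauge integral.\<close>
  have "integrable lebesgue (\<lambda>x. indicat_real (cbox a b) x *\<^sub>R g x)"
    using g by (simp add: integrable_restrict_space)
  then have "integrable lebesgue (\<lambda>x. indicat_real (box a b) x *\<^sub>R indicat_real (cbox a b) x *\<^sub>R g x)"
    by (rule integrable_mult_indicator[rotated]) simp
  moreover have "indicat_real (box a b) x * indicat_real (cbox a b) x = indicat_real (box a b) x" for x
    using box_subset_cbox[of a b] by (auto simp: indicator_def)
  ultimately have "integrable (lebesgue_on (box a b)) g"
    by (simp add: integrable_restrict_space)
  then have "integral (box a b) g = 0"
    using 1 by (simp add: lebesgue_integral_eq_integral)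
  then show ?thesis by (simp add: integral_open_interval)
qed

text \<open>All integrals over closed boxes inside \<Omega> vanish, so Lebesgue differentiation
  forces \<open>g\<close> to vanish almost everywhere in each such box, and countably many of them
  cover \<Omega>.\<close>

lemma fundamental_lemma_calculus_of_variations:
  fixes g :: "'a::euclidean_space \<Rightarrow> 'b::euclidean_space"
  assumes "open \<Omega>" "locally_integrable \<Omega> g"
    and zero: "\<And>\<phi>. \<phi> \<in> test_functions \<Omega> \<Longrightarrow> (\<integral>x. \<phi> x *\<^sub>R g x \<partial>lebesgue_on \<Omega>) = 0"
  shows "AE x in lebesgue_on \<Omega>. g x = 0"
proof -
  have [simp]: "\<Omega> \<in> sets lebesgue" using assms(1) by simp
  have cell: "negligible {x \<in> cbox a b. g x \<noteq> 0}" if ab: "cbox a b \<subseteq> \<Omega>" for a b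
  proof -
    define f where "f x = (if x \<in> cbox a b then g x else 0)" for x
    have "integrable (lebesgue_on (cbox a b)) g"
      using assms(2) ab by (auto simp: locally_integrable_def)
    then have "g integrable_on cbox a b"
      by (simp add: integrable_on_lebesgue_on)
    then have "f integrable_on UNIV"
      unfolding f_def by (simp add: integrable_restrict_UNIV)
    then have "f integrable_on cbox c d" for c d
      using integrable_on_subcbox by blast
    \<comment> \<open>Lebesgue differentiation along cubes whose lower corner is \<open>x\<close>;
      extending by zero to \<open>f\<close> supplies integrability on every box.\<close>
    then obtain N where N: "negligible N" and lim: "\<And>x e. \<lbrakk>x \<notin> N; 0 < e\<rbrakk> \<Longrightarrow> \<exists>d>0. \<forall>h. 0 < h \<and> h < d \<longrightarrow>
        norm (integral (cbox x (x + h *\<^sub>R One)) f /\<^sub>R h ^ DIM('a) - f x) < e"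
      using integrable_ccontinuous_explicit[of f] by metis
    have "f x = 0" if x: "x \<in> box a b" "x \<notin> N" for x
    proof (rule ccontr)
      assume "f x \<noteq> 0"
      then obtain d where d: "d > 0" "\<And>h. 0 < h \<Longrightarrow> h < d \<Longrightarrow>
          norm (integral (cbox x (x + h *\<^sub>R One)) f /\<^sub>R h ^ DIM('a) - f x) < norm (f x)"
        using lim[OF x(2), of "norm (f x)"] by auto
      \<comment> \<open>The cube grows only upwards from \<open>x\<close>, so only the distance to
        the upper faces limits its side; halving \<open>d\<close> below keeps \<open>h < d\<close>
        strict.\<close>
      define r where "r = Min ((\<lambda>i. b \<bullet> i - x \<bullet> i) ` Basis)"
      have r: "r > 0" "\<And>i. i \<in> Basis \<Longrightarrow> r \<le> b \<bullet> i - x \<bullet> i"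
        using x by (auto simp: r_def box_def)
      define h where "h = min (d / 2) r"
      have h: "0 < h" "h < d" "h \<le> r" using d r by (auto simp: h_def)
      have sub: "cbox x (x + h *\<^sub>R One) \<subseteq> cbox a b"
      proof -
        have "x \<bullet> i + h \<le> b \<bullet> i" if "i \<in> Basis" for i
          using r(2)[OF that] h by simp
        then show ?thesis
          using x h by (auto simp: box_def subset_box inner_add_left less_imp_le)
      qed
      have "integral (cbox x (x + h *\<^sub>R One)) f = integral (cbox x (x + h *\<^sub>R One)) g"
        using sub by (intro Henstock_Kurzweil_Integration.integral_cong) (auto simp: f_def)
      also have "\<dots> = 0"
        using sub ab by (intro integral_cbox_eq_0[OF _ assms(2) _ zero]) auto
      finally show False using d(2)[OF h(1,2)] by simp
    qed
    then have "{x \<in> cbox a b. f x \<noteq> 0} \<subseteq> N \<union> (cbox a b - box a b)"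
      by blast
    moreover have "{x \<in> cbox a b. g x \<noteq> 0} = {x \<in> cbox a b. f x \<noteq> 0}"
      by (auto simp: f_def)
    ultimately show ?thesis
      using negligible_subset[OF negligible_Un[OF N negligible_frontier_interval[of a b]]] by simp
  qed
  obtain \<D> where \<D>: "countable \<D>" "\<D> \<subseteq> Pow \<Omega>" "\<And>X. X \<in> \<D> \<Longrightarrow> \<exists>a b. X = cbox a b" "\<Union>\<D> = \<Omega>"
    using open_countable_Union_open_cbox[OF assms(1)] by metis
  have "negligible (\<Union>X\<in>\<D>. {x \<in> X. g x \<noteq> 0})"
  proof (rule negligible_countable_Union)
    show "countable ((\<lambda>X. {x \<in> X. g x \<noteq> 0}) ` \<D>)" using \<D>(1) by simp
    fix Y assume "Y \<in> (\<lambda>X. {x \<in> X. g x \<noteq> 0}) ` \<D>"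
    then obtain X where "X \<in> \<D>" and Y: "Y = {x \<in> X. g x \<noteq> 0}" by blast
    moreover from this obtain a b where "X = cbox a b" using \<D>(3) by blast
    ultimately show "negligible Y"
      using cell[of a b] \<D>(2) by auto
  qed
  moreover have "(\<Union>X\<in>\<D>. {x \<in> X. g x \<noteq> 0}) = {x \<in> \<Omega>. g x \<noteq> 0}"
    using \<D>(4) by auto
  ultimately have "{x \<in> \<Omega>. g x \<noteq> 0} \<in> null_sets lebesgue"
    by (simp add: negligible_iff_null_sets)
  then have "AE x in lebesgue. x \<in> \<Omega> \<longrightarrow> g x = 0"
    by (rule AE_I') auto
  then show ?thesis by (simp add: AE_restrict_space_iff)
qed

lemma has_weak_grad_unique:
  assumes "open \<Omega>" "has_weak_grad \<Omega> u g" "has_weak_grad \<Omega> u h"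
  shows "AE x in lebesgue_on \<Omega>. g x = h x"
proof -
  have loc: "locally_integrable \<Omega> g" "locally_integrable \<Omega> h"
    using assms by (auto simp: has_weak_grad_def)
  have "AE x in lebesgue_on \<Omega>. g x - h x = 0"
  proof (rule fundamental_lemma_calculus_of_variations[OF assms(1)])
    show "locally_integrable \<Omega> (\<lambda>x. g x - h x)"
      using loc by (auto simp: locally_integrable_def)
    fix \<phi> assume \<phi>: "\<phi> \<in> test_functions \<Omega>"
    have eq: "(\<integral>x. \<phi> x *\<^sub>R g x \<partial>lebesgue_on \<Omega>) = (\<integral>x. \<phi> x *\<^sub>R h x \<partial>lebesgue_on \<Omega>)"
      using assms \<phi> by (auto simp: has_weak_grad_def)
    have "integrable (lebesgue_on \<Omega>) (\<lambda>x. \<phi> x *\<^sub>R g x)" "integrable (lebesgue_on \<Omega>) (\<lambda>x. \<phi> x *\<^sub>R h x)"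
      using loc \<phi> assms(1) by (auto intro!: integrable_test_function_scaleR)
    then show "(\<integral>x. \<phi> x *\<^sub>R (g x - h x) \<partial>lebesgue_on \<Omega>) = 0"
      using eq by (simp add: scaleR_diff_right)
  qed
  then show ?thesis by simp
qed

text \<open>Lebesgue measure is complete; multiplying by the indicator of \<open>S\<close> moves the
  claim to the whole space, where completeness applies.\<close>

lemma borel_measurable_lebesgue_on_AE:
  fixes g h :: "'a::euclidean_space \<Rightarrow> 'b::euclidean_space"
  assumes "S \<in> sets lebesgue" "g \<in> borel_measurable (lebesgue_on S)"
    and "AE x in lebesgue_on S. g x = h x"
  shows "h \<in> borel_measurable (lebesgue_on S)"
proof -
  have S: "S \<inter> space lebesgue \<in> sets lebesgue" using assms(1) by simp
  have "AE x in lebesgue. x \<in> S \<longrightarrow> g x = h x"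
    using assms(3) unfolding AE_restrict_space_iff[OF S] .
  then have "AE x in lebesgue. indicat_real S x *\<^sub>R g x = indicat_real S x *\<^sub>R h x"
    by eventually_elim (auto simp: indicator_def)
  then show ?thesis
    using borel_measurable_AE[OF assms(2)[unfolded borel_measurable_restrict_space_iff[OF S]]]
    unfolding borel_measurable_restrict_space_iff[OF S] by simp
qed

text \<open>The chosen gradient may differ from the \<open>Lp\<close> witness, but only on a null
  set, so measurability and integrability carry over.\<close>

lemma weak_grad_in_Lp:
  assumes "open \<Omega>" "u \<in> sobolev q \<Omega>"
  shows "weak_grad \<Omega> u \<in> Lp q \<Omega>"
proof -
  obtain g where g: "g \<in> Lp q \<Omega>" "has_weak_grad \<Omega> u g"
    using assms(2) by (auto simp: sobolev_def)
  have "has_weak_grad \<Omega> u (weak_grad \<Omega> u)"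
    unfolding weak_grad_def using g(2) by (rule someI[of "has_weak_grad \<Omega> u"])
  then have ae: "AE x in lebesgue_on \<Omega>. g x = weak_grad \<Omega> u x"
    by (rule has_weak_grad_unique[OF assms(1) g(2)])
  have meas: "weak_grad \<Omega> u \<in> borel_measurable (lebesgue_on \<Omega>)"
    by (rule borel_measurable_lebesgue_on_AE[OF _ _ ae]) (use g assms(1) in \<open>auto simp: Lp_def\<close>)
  moreover have "integrable (lebesgue_on \<Omega>) (\<lambda>x. norm (weak_grad \<Omega> u x) powr q)"
  proof (rule integrable_cong_AE_imp)
    show "integrable (lebesgue_on \<Omega>) (\<lambda>x. norm (g x) powr q)" using g by (simp add: Lp_def)
    show "(\<lambda>x. norm (weak_grad \<Omega> u x) powr q) \<in> borel_measurable (lebesgue_on \<Omega>)"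
      using meas by measurable
    show "AE x in lebesgue_on \<Omega>. norm (g x) powr q = norm (weak_grad \<Omega> u x) powr q"
      using ae by eventually_elim simp
  qed
  ultimately show ?thesis by (simp add: Lp_def)
qed

section \<open>Energy contraction\<close>

lemma integrable_inner_weighted:
  fixes x y :: "'a \<Rightarrow> 'b::euclidean_space"
  assumes "x \<in> borel_measurable M" "y \<in> borel_measurable M" "a \<in> borel_measurable M"
    and "integrable M (\<lambda>t. (norm (x t))\<^sup>2)" "integrable M (\<lambda>t. (norm (y t))\<^sup>2)"
    and a: "\<And>t. 0 \<le> a t" "\<And>t. a t \<le> C"
  shows "integrable M (\<lambda>t. a t * (x t \<bullet> y t))"
proof (rule Bochner_Integration.integrable_bound)
  show "integrable M (\<lambda>t. C * ((norm (x t))\<^sup>2 + (norm (y t))\<^sup>2))"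
    using assms by simp
  show "(\<lambda>t. a t * (x t \<bullet> y t)) \<in> borel_measurable M"
    using assms(1-3) by measurable
  show "AE t in M. norm (a t * (x t \<bullet> y t)) \<le> norm (C * ((norm (x t))\<^sup>2 + (norm (y t))\<^sup>2))"
  proof (intro AE_I2)
    fix t
    have "\<bar>x t \<bullet> y t\<bar> \<le> norm (x t) * norm (y t)"
      by (rule Cauchy_Schwarz_ineq2)
    also have "\<dots> \<le> (norm (x t))\<^sup>2 + (norm (y t))\<^sup>2"
      using sum_squares_bound[of "norm (x t)" "norm (y t)"] mult_nonneg_nonneg[OF norm_ge_zero norm_ge_zero, of "x t" "y t"]
      by linarith
    finally have "a t * \<bar>x t \<bullet> y t\<bar> \<le> C * ((norm (x t))\<^sup>2 + (norm (y t))\<^sup>2)"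
      using a[of t] by (intro mult_mono) auto
    moreover have "0 \<le> C" using a[of t] by linarith
    ultimately show "norm (a t * (x t \<bullet> y t)) \<le> norm (C * ((norm (x t))\<^sup>2 + (norm (y t))\<^sup>2))"
      using a(1)[of t] by (simp add: abs_mult)
  qed
qed

text \<open>Testing the scheme with \<open>v\<close>, \<open>v'\<close> and \<open>u\<close> themselves replaces every value of \<open>f\<close> in the
  energies by an integral, which reduces the claim to the pointwise one.\<close>
lemma kacanov_step:
  fixes \<Omega> :: "'a::euclidean_space set"
  assumes p: "1 < p" "p < 2" and e: "0 < em" "em \<le> ep"
    and \<Omega>: "open \<Omega>" "bounded \<Omega>"
    and mem: "u \<in> sobolev0 2 \<Omega>" "v \<in> sobolev0 2 \<Omega>" "v' \<in> sobolev0 2 \<Omega>"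
    and step: "\<And>\<xi>. \<xi> \<in> sobolev0 2 \<Omega> \<Longrightarrow>
      (\<integral>x. clamp_between em ep (norm (weak_grad \<Omega> v x)) powr (p - 2) *
        (weak_grad \<Omega> v' x \<bullet> weak_grad \<Omega> \<xi> x) \<partial>lebesgue_on \<Omega>) = f \<xi>"
  shows "(p - 1) * (em / ep) powr (2 - p) *
      (relaxed_energy p \<Omega> f em ep v - relaxed_energy p \<Omega> f em ep u)
    \<le> relaxed_energy p \<Omega> f em ep v - relaxed_energy p \<Omega> f em ep v'"
proof -
  let ?M = "lebesgue_on \<Omega>" and ?G = "weak_grad \<Omega>"
  let ?k = "\<lambda>w x. kappa p em ep (norm (?G w x))"
  let ?b = "\<lambda>w x. clamp_between em ep (norm (?G v x)) powr (p - 2) * (?G v' x \<bullet> ?G w x)"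
  have [simp]: "\<Omega> \<in> sets lebesgue" using \<Omega> by simp
  \<comment> \<open>Finite measure makes the constant \<open>kappa p em ep 0\<close> integrable,
    which the bound on the energy density requires.\<close>
  have "emeasure lebesgue \<Omega> < \<infinity>"
    using \<Omega> emeasure_bounded_finite by fastforce
  then have "finite_measure ?M"
    by (intro finite_measureI) (simp add: emeasure_restrict_space space_restrict_space)
  then interpret finite_measure ?M .
  have G: "?G w \<in> borel_measurable ?M" "integrable ?M (\<lambda>x. (norm (?G w x))\<^sup>2)"
    if "w \<in> sobolev0 2 \<Omega>" for w
    using weak_grad_in_Lp[of \<Omega> w 2] \<Omega> that by (auto simp: sobolev0_def Lp_def)
  have k: "integrable ?M (?k w)" if w: "w \<in> sobolev0 2 \<Omega>" for w
  proof (rule Bochner_Integration.integrable_bound)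
    show "integrable ?M (\<lambda>x. kappa p em ep 0 + em powr (p - 2) / 2 * (norm (?G w x))\<^sup>2)"
      using G[OF w] by simp
    show "?k w \<in> borel_measurable ?M"
      using G[OF w] kappa_measurable[OF p e] by measurable
    show "AE x in ?M. norm (?k w x) \<le> norm (kappa p em ep 0 + em powr (p - 2) / 2 * (norm (?G w x))\<^sup>2)"
      using kappa_nonneg[OF p e] kappa_le[OF p e]
      by (intro AE_I2) (auto intro: order_trans[OF _ abs_ge_self])
  qed
  have b: "integrable ?M (?b w)" if w: "w \<in> sobolev0 2 \<Omega>" for w
    using G mem w weight_le[OF p e]
    by (intro integrable_inner_weighted[where C = "em powr (p - 2)"]) (auto simp: clamp_between_def)
  have E: "relaxed_energy p \<Omega> f em ep w = (\<integral>x. ?k w x \<partial>?M) - (\<integral>x. ?b w x \<partial>?M)"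
    if "w \<in> sobolev0 2 \<Omega>" for w
    using step[OF that] by (simp add: relaxed_energy_def)
  let ?d = "(p - 1) * (em / ep) powr (2 - p)"
  have "?d * (relaxed_energy p \<Omega> f em ep v - relaxed_energy p \<Omega> f em ep u) =
      (\<integral>x. ?d * (?k v x - ?k u x - ?b v x + ?b u x) \<partial>?M)"
    using k b mem by (simp add: E)
  also have "\<dots> \<le> (\<integral>x. ?k v x - ?k v' x - ?b v x + ?b v' x \<partial>?M)"
    using k b mem by (intro integral_mono kacanov_pointwise[OF p e]) auto
  also have "\<dots> = relaxed_energy p \<Omega> f em ep v - relaxed_energy p \<Omega> f em ep v'"
    using k b mem by (simp add: E)
  finally show ?thesis .
qed

theorem corollary19:
  fixes \<Omega> :: "'a::euclidean_space set" and p :: real and f :: "('a \<Rightarrow> real) \<Rightarrow> real"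
  assumes "open \<Omega>" and "bounded \<Omega>" and "1 < p" and "p < 2"
    and "f \<in> sobolev0_dual p \<Omega>"
  shows "\<exists>cK>1. \<forall>(em::real) (ep::real) (u :: 'a \<Rightarrow> real) (v :: nat \<Rightarrow> 'a \<Rightarrow> real).
      0 < em \<longrightarrow> em \<le> ep \<longrightarrow>
      is_arg_min (relaxed_energy p \<Omega> f em ep) (\<lambda>w. w \<in> sobolev0 2 \<Omega>) u \<longrightarrow>
      (\<forall>n. v n \<in> sobolev0 2 \<Omega>) \<longrightarrow>
      (\<forall>n. \<forall>\<xi>\<in>sobolev0 2 \<Omega>.
         (\<integral>x. clamp_between em ep (norm (weak_grad \<Omega> (v n) x)) powr (p - 2) *
               (weak_grad \<Omega> (v (Suc n)) x \<bullet> weak_grad \<Omega> \<xi> x) \<partial>lebesgue_on \<Omega>) = f \<xi>) \<longrightarrow>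
      (\<forall>n. relaxed_energy p \<Omega> f em ep (v n) - relaxed_energy p \<Omega> f em ep u
         \<le> (1 - 1 / cK * (em / ep) powr (2 - p)) ^ n *
            (relaxed_energy p \<Omega> f em ep (v 0) - relaxed_energy p \<Omega> f em ep u))"
proof (rule exI[of _ "1 / (p - 1)"], intro conjI allI impI)
  \<comment> \<open>The witness depends on \<open>p\<close> alone, hence serves every relaxation
    interval; it exceeds 1 because \<open>p < 2\<close>.\<close>
  show "1 < 1 / (p - 1)" using assms by (simp add: field_simps)
next
  fix em ep :: real and u :: "'a \<Rightarrow> real" and v :: "nat \<Rightarrow> 'a \<Rightarrow> real" and n
  assume e: "0 < em" "em \<le> ep"
    and u: "is_arg_min (relaxed_energy p \<Omega> f em ep) (\<lambda>w. w \<in> sobolev0 2 \<Omega>) u"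
    and v: "\<forall>n. v n \<in> sobolev0 2 \<Omega>"
    and scheme: "\<forall>n. \<forall>\<xi>\<in>sobolev0 2 \<Omega>.
         (\<integral>x. clamp_between em ep (norm (weak_grad \<Omega> (v n) x)) powr (p - 2) *
               (weak_grad \<Omega> (v (Suc n)) x \<bullet> weak_grad \<Omega> \<xi> x) \<partial>lebesgue_on \<Omega>) = f \<xi>"
  define \<delta> where "\<delta> = (p - 1) * (em / ep) powr (2 - p)"
  let ?J = "relaxed_energy p \<Omega> f em ep"
  \<comment> \<open>This yields \<open>\<delta> \<le> 1\<close>, so the induction hypothesis may be
    multiplied by the nonnegative factor \<open>1 - \<delta>\<close>.\<close>
  have "(em / ep) powr (2 - p) \<le> 1"
    using e assms by (intro powr_le1) auto
  then have \<delta>: "\<delta> \<le> 1"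
    using assms unfolding \<delta>_def by (intro mult_le_one) auto
  have "\<delta> * (?J (v n) - ?J u) \<le> ?J (v n) - ?J (v (Suc n))" for n
    unfolding \<delta>_def
  proof (rule kacanov_step[OF assms(3,4) e assms(1,2)])
    show "u \<in> sobolev0 2 \<Omega>" using u by (simp add: is_arg_min_def)
  qed (use v scheme in blast)+
  then have contract: "?J (v (Suc n)) - ?J u \<le> (1 - \<delta>) * (?J (v n) - ?J u)" for n
    by (simp add: algebra_simps)
  have "?J (v n) - ?J u \<le> (1 - \<delta>) ^ n * (?J (v 0) - ?J u)"
  proof (induction n)
    case (Suc n)
    have "(1 - \<delta>) * (?J (v n) - ?J u) \<le> (1 - \<delta>) * ((1 - \<delta>) ^ n * (?J (v 0) - ?J u))"
      using Suc \<delta> by (intro mult_left_mono) auto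
    then show ?case using contract[of n] by simp
  qed simp
  then show "?J (v n) - ?J u \<le> (1 - 1 / (1 / (p - 1)) * (em / ep) powr (2 - p)) ^ n * (?J (v 0) - ?J u)"
    by (simp add: \<delta>_def)
qed

end
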